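(* Let $q \geq 2$ and let $n, r$ be positive integers with $r \leq n-1$. Let $P_{n,q}$ be the probability measure on partitions of $n$ given by \[ P_{n,q}(\lambda) = \frac{q^n (\frac{1}{q})_n}{\prod_{j \geq 1} q^{(\lambda_j')^2} (\frac{1}{q})_{m_j(\lambda)}}, \] and let $P_{n,q}^r$ be the $P_{n,q}$-probability that $\lambda_1 < r$. Then \begin{enumerate} \item $P_{n,q}^r \leq \left(\frac{1}{1-1/q}\right)^2 \left[\frac{1}{q^{2n-2r+2}} + \frac{1}{1-1/q^{2n+1}} \cdot \frac{1}{q^{n+1}}\right]$; \item $P_{n,q}^r \geq \frac{1}{q^{2n-2r+2}} - \frac{1}{q^{n+1}(1-1/q)} - \frac{1}{q^{2n-2r+3}(1-1/q)^2} - \frac{1}{q^{3n-3r+4}(1-1/q)^3} - \frac{1}{(1-1/q)^2}\cdot\frac{1}{q^{2n+3}(1-1/q^{2n+3})}$. \end{enumerate}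
   Context: For a partition $\lambda$, $\lambda_1$ is its largest part, $m_i(\lambda)$ the number of parts equal to $i$, and $\lambda'$ the transpose partition with $\lambda_i' = m_i(\lambda)+m_{i+1}(\lambda)+\cdots$. Notation: $(x)_n = (1-x)(1-x/q)\cdots(1-x/q^{n-1})$, so $(1/q)_n = \prod_{i=1}^n(1-1/q^i)$. *)

theory Defs
  imports "HOL-Analysis.Analysis" "HOL-Library.Multiset"
begin

text \<open>
  A partition $\lambda$ of \<open>n\<close> is the multiset \<open>p\<close> of its (positive) parts, so the number
  $m_i(\lambda)$ of parts equal to \<open>i\<close> is \<open>count p i\<close>.
\<close>

definition partitions_of :: "nat \<Rightarrow> nat multiset set" where
  "partitions_of n = {p. 0 \<notin># p \<and> sum_mset p = n}"

text \<open>The empty partition gets largest part \<open>0\<close>.\<close>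

definition largest_part :: "nat multiset \<Rightarrow> nat" where
  "largest_part p = Max (insert 0 (set_mset p))"

text \<open>
  \<open>transpose_part p i\<close> is $\lambda'_i = m_i(\lambda) + m_{i+1}(\lambda) + \cdots$; the terms
  beyond the largest part vanish.
\<close>

definition transpose_part :: "nat multiset \<Rightarrow> nat \<Rightarrow> nat" where
  "transpose_part p i = (\<Sum>j = i..largest_part p. count p j)"

text \<open>\<open>qpoch q x n\<close> is $(x)_n = (1-x)(1-x/q)\cdots(1-x/q^{n-1})$.\<close>

definition qpoch :: "real \<Rightarrow> real \<Rightarrow> nat \<Rightarrow> real" where
  "qpoch q x n = (\<Prod>i<n. 1 - x / q ^ i)"

text \<open>
  The product over all \<open>j \<ge> 1\<close> is cut off at the largest part: for larger \<open>j\<close> both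
  $\lambda'_j$ and $m_j(\lambda)$ are \<open>0\<close>, so the factor is \<open>1\<close>.
\<close>

definition partition_weight :: "nat \<Rightarrow> real \<Rightarrow> nat multiset \<Rightarrow> real" where
  "partition_weight n q p =
     q ^ n * qpoch q (1 / q) n /
     (\<Prod>j = 1..largest_part p. q ^ ((transpose_part p j)\<^sup>2) * qpoch q (1 / q) (count p j))"

definition partition_measure :: "nat \<Rightarrow> real \<Rightarrow> nat multiset measure" where
  "partition_measure n q =
     point_measure (partitions_of n) (\<lambda>p. ennreal (partition_weight n q p))"

definition prob_largest_part_less :: "nat \<Rightarrow> real \<Rightarrow> nat \<Rightarrow> real" where
  "prob_largest_part_less n q r =
     measure (partition_measure n q) {p \<in> partitions_of n. largest_part p < r}"

end

theory Submission
  imports Defs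
begin

text \<open>
  Put \<open>t = 1 / q\<close>. Adjoining a new largest part \<open>a\<close> to a partition \<open>p\<close> of \<open>M\<close> multiplies its
  normalised weight by \<open>t^(2 * M) / (1 - t^(count p a + 1))\<close>. Deleting the largest part therefore
  bounds the sum over partitions of \<open>n\<close> with largest part below \<open>r\<close> by a sum over
  \<open>M \<ge> n - r + 1\<close> of \<open>t^(2 * M) / (1 - t)\<close> times the total normalised weight of the partitions of
  \<open>M\<close>, which the same recursion controls; the geometric series in \<open>M\<close> is the upper bound.
  The lower bound comes from the single partition \<open>(r - 1, n - r + 1)\<close>, which exists when
  \<open>n - r + 1 \<le> r - 1\<close>; otherwise \<open>2 * n - 2 * r + 2 \<ge> n + 1\<close> and the bound is not positive.
\<close>

section \<open>Adjoining a largest part\<close>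

text \<open>Leaving out the factor \<open>qpoch q (1 / q) n\<close> makes partitions of different
  sizes comparable. For prime \<open>q\<close> and a partition \<open>p\<close> this is the order of
  the finite abelian \<open>q\<close>-group of type \<open>p\<close> divided by the number of its
  automorphisms.\<close>

definition normalised_weight :: "real \<Rightarrow> nat multiset \<Rightarrow> real" where
  "normalised_weight q p = q ^ sum_mset p /
     (\<Prod>j = 1..largest_part p. q ^ ((transpose_part p j)\<^sup>2) * qpoch q (1 / q) (count p j))"

lemma qpoch_Suc: "qpoch q (1 / q) (Suc n) = qpoch q (1 / q) n * (1 - (1 / q) ^ Suc n)"
  by (simp add: qpoch_def power_divide)

lemma qpoch_0: "qpoch q x 0 = 1"
  by (simp add: qpoch_def)

lemma qpoch_pos:
  assumes "q > 1" shows "qpoch q (1 / q) n > 0"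
proof (induction n)
  case (Suc n)
  have "(1 / q) ^ Suc n < 1" using assms by (intro power_Suc_less_one) auto
  with Suc show ?case by (simp only: qpoch_Suc) simp
qed (simp add: qpoch_0)

lemma qpoch_antimono:
  assumes "q > 1" "m \<le> n" shows "qpoch q (1 / q) n \<le> qpoch q (1 / q) m"
  using assms(2)
proof (induction rule: dec_induct)
  case (step k)
  have "qpoch q (1 / q) (Suc k) \<le> qpoch q (1 / q) k"
    unfolding qpoch_Suc using qpoch_pos[OF assms(1), of k] assms(1)
    by (intro mult_left_le) auto
  with step show ?case by simp
qed simp

lemma count_beyond_largest_part:
  assumes "j > largest_part p" shows "count p j = 0"
proof (rule ccontr)
  assume "count p j \<noteq> 0"
  then have "j \<le> largest_part p" unfolding largest_part_def by (intro Max_ge) auto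
  with assms show False by simp
qed

text \<open>A cut-off \<open>b\<close> that does not depend on \<open>p\<close> lets
  \<open>p\<close> and \<open>add_mset x p\<close> be compared term by term;
  \<open>weight_product_eq\<close> does the same for the product in the weight.\<close>

lemma transpose_part_eq:
  assumes "largest_part p \<le> b"
  shows "transpose_part p i = (\<Sum>j = i..b. count p j)"
  unfolding transpose_part_def
  by (rule sum.mono_neutral_left) (use assms count_beyond_largest_part in auto)

lemma largest_part_le_iff: "largest_part p \<le> b \<longleftrightarrow> (\<forall>x\<in>#p. x \<le> b)"
  by (simp add: largest_part_def)

lemma weight_product_eq:
  assumes "largest_part p \<le> b"
  shows "(\<Prod>j = 1..largest_part p. q ^ ((transpose_part p j)\<^sup>2) * qpoch q (1 / q) (count p j))
       = (\<Prod>j = 1..b. q ^ ((transpose_part p j)\<^sup>2) * qpoch q (1 / q) (count p j))"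
proof (rule prod.mono_neutral_left)
  have "q ^ ((transpose_part p j)\<^sup>2) * qpoch q (1 / q) (count p j) = 1" if "j > largest_part p" for j
    using that by (simp add: transpose_part_def count_beyond_largest_part qpoch_0)
  then show "\<forall>j\<in>{1..b} - {1..largest_part p}.
      q ^ ((transpose_part p j)\<^sup>2) * qpoch q (1 / q) (count p j) = 1" by auto
qed (use assms in auto)

lemma transpose_part_add_mset:
  assumes "largest_part (add_mset x p) \<le> b"
  shows "transpose_part (add_mset x p) j = transpose_part p j + (if j \<le> x then 1 else 0)"
proof -
  have p: "largest_part p \<le> b" and x: "x \<le> b"
    using assms by (auto simp: largest_part_le_iff)
  have "(\<Sum>i = j..b. count (add_mset x p) i) = (\<Sum>i = j..b. count p i + (if i = x then 1 else 0))"
    by (rule sum.cong) auto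
  then show ?thesis
    using x by (simp add: transpose_part_eq[OF p] transpose_part_eq[OF assms] sum.distrib)
qed

text \<open>The cells of the Young diagram are counted by columns and by rows: each part
  \<open>x\<close> adds one cell to each of the columns \<open>1..x\<close>.\<close>

lemma sum_transpose_part:
  assumes "largest_part p \<le> b"
  shows "(\<Sum>j = 1..b. transpose_part p j) = sum_mset p"
  using assms
proof (induction p)
  case (add x p)
  have x: "x \<le> b" and p: "largest_part p \<le> b"
    using add.prems by (auto simp: largest_part_le_iff)
  have "(\<Sum>j = 1..b. if j \<le> x then 1 else 0) = (\<Sum>j = 1..x. (1::nat))"
    by (rule sum.mono_neutral_cong_right) (use x in auto)
  then show ?case
    using add.IH[OF p] by (simp add: transpose_part_add_mset[OF add.prems] sum.distrib)
qed (simp add: transpose_part_def)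

lemma normalised_weight_empty: "normalised_weight q {#} = 1"
  by (simp add: normalised_weight_def largest_part_def)

lemma normalised_weight_pos:
  assumes "q > 1" shows "normalised_weight q p > 0"
  unfolding normalised_weight_def using assms qpoch_pos[OF assms]
  by (intro divide_pos_pos prod_pos mult_pos_pos) auto

text \<open>Each of the columns \<open>1..a\<close> gains one cell, so the sum of their squares
  grows by \<open>2 * sum_mset p + a\<close>. The \<open>a\<close> cancels against the growth of the
  numerator \<open>q ^ sum_mset p\<close>, and the multiplicity of \<open>a\<close> contributes one
  new factor of \<open>qpoch\<close>.\<close>

lemma normalised_weight_add_mset:
  assumes q: "q > 1" and a: "a > 0" "largest_part p \<le> a"
  shows "normalised_weight q (add_mset a p) =
    normalised_weight q p * (1 / q) ^ (2 * sum_mset p) / (1 - (1 / q) ^ Suc (count p a))"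
proof -
  let ?p = "add_mset a p"
  have lp: "largest_part ?p = a"
    using a unfolding largest_part_def by (intro Max_eqI) (auto simp: largest_part_le_iff)
  have tp: "transpose_part ?p j = Suc (transpose_part p j)" if "j \<in> {1..a}" for j
    using that by (simp add: transpose_part_add_mset[OF eq_refl[OF lp]])
  have tp2: "(\<Sum>j = 1..a. (transpose_part ?p j)\<^sup>2)
      = (\<Sum>j = 1..a. (transpose_part p j)\<^sup>2) + (2 * sum_mset p + a)"
  proof -
    have "(\<Sum>j = 1..a. (transpose_part ?p j)\<^sup>2)
        = (\<Sum>j = 1..a. (transpose_part p j)\<^sup>2 + 2 * transpose_part p j + 1)"
      by (rule sum.cong) (simp_all add: tp power2_eq_square)
    also have "\<dots> = (\<Sum>j = 1..a. (transpose_part p j)\<^sup>2) + 2 * (\<Sum>j = 1..a. transpose_part p j) + a"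
      by (simp only: sum.distrib sum_distrib_left) simp
    finally show ?thesis unfolding sum_transpose_part[OF a(2)] by simp
  qed
  have qp: "(\<Prod>j = 1..a. qpoch q (1 / q) (count ?p j))
      = (\<Prod>j = 1..a. qpoch q (1 / q) (count p j)) * (1 - (1 / q) ^ Suc (count p a))"
  proof -
    \<comment> \<open>Only the multiplicity of \<open>a\<close> changes, so the factor at
      \<open>j = a\<close> is split off and the others agree.\<close>
    have "(\<Prod>j\<in>{1..a} - {a}. qpoch q (1 / q) (count ?p j))
        = (\<Prod>j\<in>{1..a} - {a}. qpoch q (1 / q) (count p j))"
      by (rule prod.cong) auto
    then show ?thesis
      using a(1) prod.remove[of "{1..a}" a "\<lambda>j. qpoch q (1 / q) (count ?p j)"]
        prod.remove[of "{1..a}" a "\<lambda>j. qpoch q (1 / q) (count p j)"]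
      by (simp only: finite_atLeastAtMost) (simp add: qpoch_Suc del: power_Suc)
  qed
  show ?thesis
    unfolding normalised_weight_def lp
    unfolding weight_product_eq[OF a(2)]
    unfolding prod.distrib qp power_sum[symmetric] tp2
    using q by (simp add: power_add power_divide mult_2 del: power_Suc)
qed

section \<open>Summing over partitions\<close>

lemma finite_partitions_of: "finite (partitions_of n)"
proof (rule finite_subset)
  show "partitions_of n \<subseteq> mset ` {xs. set xs \<subseteq> {..n} \<and> length xs \<le> n}"
  proof
    fix p assume p: "p \<in> partitions_of n"
    obtain xs where xs: "p = mset xs" by (metis ex_mset)
    have "size p \<le> sum_mset p" if "0 \<notin># p" for p :: "nat multiset"
      using that by (induction p) auto
    moreover have "x \<le> sum_mset p" if "x \<in># p" for x :: nat and p
      using that by (auto dest!: multi_member_split)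
    ultimately have "size p \<le> n" "set_mset p \<subseteq> {..n}"
      using p unfolding partitions_of_def by blast+
    then show "p \<in> mset ` {xs. set xs \<subseteq> {..n} \<and> length xs \<le> n}"
      using xs by auto
  qed
  show "finite (mset ` {xs. set xs \<subseteq> {..n} \<and> length xs \<le> n})"
    by (intro finite_imageI finite_lists_length_le) auto
qed

lemma prob_largest_part_less_eq:
  assumes "q > 1"
  shows "prob_largest_part_less n q r =
    qpoch q (1 / q) n * (\<Sum>p\<in>{p \<in> partitions_of n. largest_part p < r}. normalised_weight q p)"
proof -
  let ?A = "{p \<in> partitions_of n. largest_part p < r}"
  have w: "partition_weight n q p = qpoch q (1 / q) n * normalised_weight q p"
    if "p \<in> partitions_of n" for p
    using that by (simp add: partition_weight_def normalised_weight_def partitions_of_def)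
  have nn: "partition_weight n q p \<ge> 0" if "p \<in> partitions_of n" for p
    using w[OF that] qpoch_pos[OF assms] normalised_weight_pos[OF assms]
    by (simp add: less_imp_le)
  have "emeasure (partition_measure n q) ?A = (\<Sum>p\<in>?A. ennreal (partition_weight n q p))"
    unfolding partition_measure_def
    by (rule emeasure_point_measure_finite) (auto simp: finite_partitions_of)
  also have "\<dots> = ennreal (\<Sum>p\<in>?A. partition_weight n q p)"
    by (rule sum_ennreal) (use nn in auto)
  finally have "prob_largest_part_less n q r = (\<Sum>p\<in>?A. partition_weight n q p)"
    unfolding prob_largest_part_less_def measure_def
    using nn by (simp only:) (auto intro!: enn2real_ennreal sum_nonneg)
  then show ?thesis using w by (simp add: sum_distrib_left)
qed

text \<open>Every partition counted on the left is \<open>add_mset (n - M) p\<close>, with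
  \<open>n - M\<close> its largest part and \<open>p\<close> a partition of \<open>M\<close>;
  \<open>1 \<le> n - M < r\<close> gives the range of \<open>M\<close>. Equality is lost twice:
  pairs in which \<open>n - M\<close> is not the largest part are counted too, and
  \<open>1 - t^(count p a + 1)\<close> is replaced by the smaller \<open>1 - t\<close>.\<close>

lemma sum_normalised_weight_le:
  assumes q: "q > 1" and n: "n > 0"
  shows "(\<Sum>p\<in>{p \<in> partitions_of n. largest_part p < r}. normalised_weight q p)
    \<le> (\<Sum>M = n + 1 - r..<n. (1 / q) ^ (2 * M) / (1 - 1 / q) *
        (\<Sum>p\<in>partitions_of M. normalised_weight q p))"
proof -
  let ?g = "\<lambda>(M, p). (1 / q) ^ (2 * M) / (1 - 1 / q) * normalised_weight q p"
  have "(\<Sum>p\<in>{p \<in> partitions_of n. largest_part p < r}. normalised_weight q p)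
      \<le> sum ?g (SIGMA M:{n + 1 - r..<n}. partitions_of M)"
  proof (rule sum_le_included[where i = "\<lambda>(M, p). add_mset (n - M) p"])
    show "\<forall>y\<in>(SIGMA M:{n + 1 - r..<n}. partitions_of M). 0 \<le> ?g y"
      using q normalised_weight_pos[OF q] by (auto simp: less_imp_le)
    show "\<forall>x\<in>{p \<in> partitions_of n. largest_part p < r}.
        \<exists>y\<in>(SIGMA M:{n + 1 - r..<n}. partitions_of M).
          (case y of (M, p) \<Rightarrow> add_mset (n - M) p) = x \<and> normalised_weight q x \<le> ?g y"
    proof
      fix x assume x: "x \<in> {p \<in> partitions_of n. largest_part p < r}"
      then have "x \<noteq> {#}" using n by (auto simp: partitions_of_def)
      \<comment> \<open>As \<open>x\<close> is nonempty, the maximum is a genuine part and not the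
        default \<open>0\<close>.\<close>
      then have "largest_part x \<in># x"
        unfolding largest_part_def using Max_in[of "set_mset x"] by (simp add: max_def)
      then obtain p where p: "x = add_mset (largest_part x) p"
        by (metis multi_member_split)
      define a where "a = largest_part x"
      have xa: "x = add_mset a p" and ar: "a < r"
        using p x unfolding a_def by auto
      have a0: "a > 0" and p0: "0 \<notin># p" and an: "a + sum_mset p = n"
        using x unfolding xa by (auto simp: partitions_of_def)
      have pa: "largest_part p \<le> a"
        using largest_part_le_iff[of x "largest_part x"] xa unfolding a_def
        by (metis add_mset_add_single largest_part_le_iff order_refl union_iff)
      have "(1 / q) ^ Suc (count p a) \<le> 1 / q"
        using q power_decreasing[of 1 "Suc (count p a)" "1 / q"] by simp
      then have "normalised_weight q x \<le> ?g (sum_mset p, p)"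
        using q normalised_weight_pos[OF q, of p]
        unfolding xa normalised_weight_add_mset[OF q a0 pa]
        by (auto intro!: divide_left_mono mult_pos_pos simp: mult.commute less_imp_le
              power_Suc_less_one simp del: power_Suc)
      moreover have "(sum_mset p, p) \<in> (SIGMA M:{n + 1 - r..<n}. partitions_of M)"
        using an a0 ar p0 by (auto simp: partitions_of_def)
      ultimately show "\<exists>y\<in>(SIGMA M:{n + 1 - r..<n}. partitions_of M).
          (case y of (M, p) \<Rightarrow> add_mset (n - M) p) = x \<and> normalised_weight q x \<le> ?g y"
        using an xa by (intro bexI[of _ "(sum_mset p, p)"]) auto
    qed
  qed (auto simp: finite_partitions_of)
  also have "\<dots> = (\<Sum>M = n + 1 - r..<n. (1 / q) ^ (2 * M) / (1 - 1 / q) *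
        (\<Sum>p\<in>partitions_of M. normalised_weight q p))"
    by (simp add: sum.Sigma[symmetric] finite_partitions_of sum_distrib_left)
  finally show ?thesis .
qed

section \<open>Total normalised weight of the partitions of a given size\<close>

text \<open>This closes the induction in \<open>total_weight_le\<close>: the bound
  \<open>(1 + t) / ?c M\<close>, inserted into the recursion for \<open>1 \<le> M < n\<close>,
  reproduces itself at \<open>n\<close>. The constant \<open>1 + t\<close> later cancels against a
  factor of \<open>1 - t\<^sup>2\<close>.\<close>

lemma total_weight_recursion_bound:
  assumes q: "q \<ge> 2" and n: "n > 0"
  shows "(1 + (\<Sum>M = 1..<n. (1 / q) ^ (2 * M) * ((1 + 1 / q) / qpoch q (1 / q) M))) / (1 - 1 / q)
    \<le> (1 + 1 / q) / qpoch q (1 / q) n"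
proof -
  define t where "t = 1 / q"
  have t: "0 < t" "t \<le> 1 / 2" using q by (auto simp: t_def field_simps)
  let ?c = "qpoch q (1 / q)"
  have c: "?c k > 0" for k using q by (intro qpoch_pos) auto
  \<comment> \<open>The induction starts at \<open>2\<close> because its step needs
    \<open>t ^ (k - 1) \<le> 1 - t\<close>, which fails for \<open>k = 1\<close>.\<close>
  consider "n = 1" | "n \<ge> 2" using n by linarith
  then have "(1 + (\<Sum>M = 1..<n. t ^ (2 * M) * ((1 + t) / ?c M))) / (1 - t) \<le> (1 + t) / ?c n"
  proof cases
    case 1
    then show ?thesis using t
      by (simp add: qpoch_def t_def[symmetric] divide_right_mono)
  next
    case 2
    then show ?thesis
    proof (induction rule: dec_induct)
      case base
      have c1: "?c 1 = 1 - t" and c2: "?c 2 = (1 - t) * (1 - t\<^sup>2)"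
        by (simp_all add: numeral_2_eq_2 qpoch_Suc qpoch_0 t_def)
      have "t * t \<le> 1 / 2 * t" using t by (intro mult_right_mono) auto
      moreover have "t * (t * t) \<le> 1 / 2 * (t * t)" using t by (intro mult_right_mono) auto
      moreover have "t * t \<le> t" using t by (simp add: mult_le_cancel_right1)
      ultimately have "t\<^sup>2 + t ^ 3 \<le> t" by (simp add: power2_eq_square power3_eq_cube mult.assoc)
      then have "1 - t + t\<^sup>2 * (1 + t) \<le> 1"
        by (simp add: power2_eq_square power3_eq_cube algebra_simps)
      moreover have "1 + t\<^sup>2 * ((1 + t) / (1 - t)) = (1 - t + t\<^sup>2 * (1 + t)) / (1 - t)"
        using t by (simp add: field_simps)
      ultimately have "(1 + t\<^sup>2 * ((1 + t) / (1 - t))) / (1 - t) \<le> 1 / (1 - t) / (1 - t)"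
        using t by (simp add: divide_right_mono)
      also have "\<dots> = (1 + t) / ((1 - t) * (1 - t\<^sup>2))"
      proof -
        have "1 - t\<^sup>2 = (1 - t) * (1 + t)" by (simp add: power2_eq_square algebra_simps)
        then show ?thesis using t by simp
      qed
      finally show ?case using c1 c2 by (simp add: numeral_2_eq_2)
    next
      case (step k)
      \<comment> \<open>Passing from \<open>k\<close> to \<open>Suc k\<close> multiplies the right
        side by \<open>1 / (1 - t ^ Suc k)\<close>, so it suffices that the new summand, relative to
        the bound at \<open>k\<close>, is at most \<open>t ^ Suc k\<close>. Here
        \<open>q \<ge> 2\<close> enters through \<open>t \<le> 1 - t\<close>.\<close>
      have "t ^ (k - 1) \<le> t ^ 1" using t step by (intro power_decreasing) auto
      then have "t ^ (k - 1) \<le> 1 - t" using t by simp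
      then have "t ^ (k - 1) * t ^ Suc k \<le> (1 - t) * t ^ Suc k"
        using t by (intro mult_right_mono) auto
      moreover have "t ^ (k - 1) * t ^ Suc k = t ^ (2 * k)"
        using step by (simp only: power_add[symmetric]) (simp add: mult_2)
      ultimately have "t ^ (2 * k) \<le> (1 - t) * t ^ Suc k" by (simp only:)
      then have e: "t ^ (2 * k) / (1 - t) \<le> t ^ Suc k"
        using t by (simp add: divide_le_eq mult.commute[of _ "1 - t"] del: power_Suc)
      have s: "t ^ Suc k < 1" using t by (intro power_Suc_less_one) auto
      have "1 + t ^ Suc k \<le> 1 / (1 - t ^ Suc k)"
        using s by (simp add: field_simps del: power_Suc)
      with e have f: "1 + t ^ (2 * k) / (1 - t) \<le> 1 / (1 - t ^ Suc k)" by linarith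
      have "(1 + (\<Sum>M = 1..<Suc k. t ^ (2 * M) * ((1 + t) / ?c M))) / (1 - t)
          = (1 + (\<Sum>M = 1..<k. t ^ (2 * M) * ((1 + t) / ?c M))) / (1 - t)
            + t ^ (2 * k) / (1 - t) * ((1 + t) / ?c k)"
        using step by (simp add: add_divide_distrib)
      also have "\<dots> \<le> (1 + t ^ (2 * k) / (1 - t)) * ((1 + t) / ?c k)"
        using step.IH by (simp add: algebra_simps)
      also have "\<dots> \<le> 1 / (1 - t ^ Suc k) * ((1 + t) / ?c k)"
        using f t c[of k] by (intro mult_right_mono) auto
      also have "\<dots> = (1 + t) / ?c (Suc k)"
        by (simp add: qpoch_Suc t_def mult.commute del: power_Suc)
      finally show ?case .
    qed
  qed
  then show ?thesis by (simp add: t_def)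
qed

text \<open>Strong induction on \<open>n\<close>, deleting the largest part.\<close>

lemma total_weight_le:
  assumes q: "q \<ge> 2"
  shows "(\<Sum>p\<in>partitions_of n. normalised_weight q p) \<le> (1 + 1 / q) / qpoch q (1 / q) n"
proof (induction n rule: less_induct)
  case (less n)
  have p0: "partitions_of 0 = {{#}}"
    by (auto simp: partitions_of_def) (metis multiset_nonemptyE)
  let ?C = "\<lambda>M. \<Sum>p\<in>partitions_of M. normalised_weight q p"
  show ?case
  proof (cases "n = 0")
    case True
    then show ?thesis using q by (simp add: p0 normalised_weight_empty qpoch_0)
  next
    case False
    \<comment> \<open>With \<open>r = n + 1\<close> the restriction on the largest part is vacuous
      and the recursion covers all partitions of \<open>n\<close>.\<close>
    have "largest_part p < n + 1" if "p \<in> partitions_of n" for p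
    proof -
      have "x \<le> sum_mset p" if "x \<in># p" for x using that by (auto dest!: multi_member_split)
      then show ?thesis using that by (simp add: less_Suc_eq_le largest_part_le_iff partitions_of_def)
    qed
    then have "{p \<in> partitions_of n. largest_part p < n + 1} = partitions_of n" by auto
    then have "?C n \<le> (\<Sum>M = 0..<n. (1 / q) ^ (2 * M) / (1 - 1 / q) * ?C M)"
      using sum_normalised_weight_le[of q n "n + 1"] q False by simp
    \<comment> \<open>The term \<open>M = 0\<close> keeps its exact value \<open>1\<close>; the
      inductive bound there would be \<open>1 + t\<close>, too weak to close the induction.\<close>
    also have "\<dots> = (1 + (\<Sum>M = 1..<n. (1 / q) ^ (2 * M) * ?C M)) / (1 - 1 / q)"
      using False
      by (simp add: sum.atLeast_Suc_lessThan p0 normalised_weight_empty add_divide_distrib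
          sum_divide_distrib)
    also have "\<dots> \<le> (1 + (\<Sum>M = 1..<n. (1 / q) ^ (2 * M) * ((1 + 1 / q) / qpoch q (1 / q) M)))
        / (1 - 1 / q)"
      using q less.IH
      by (intro divide_right_mono add_left_mono sum_mono mult_left_mono) auto
    also have "\<dots> \<le> (1 + 1 / q) / qpoch q (1 / q) n"
      using total_weight_recursion_bound[OF q] False by simp
    finally show ?thesis .
  qed
qed

section \<open>Upper bound for the probability\<close>

lemma geometric_sum_le:
  fixes x :: real
  assumes "0 \<le> x" "x < 1"
  shows "(\<Sum>k = m..<n. x ^ k) \<le> x ^ m / (1 - x)"
proof (cases "m \<le> n")
  case True
  then have "(\<Sum>k = m..<n. x ^ k) = (x ^ m - x ^ n) / (1 - x)"
  proof (induction n rule: dec_induct)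
    case (step k)
    have "x ^ k = (x ^ k - x ^ Suc k) / (1 - x)" using assms by (simp add: divide_simps algebra_simps)
    with step show ?case by (simp add: diff_divide_distrib)
  qed simp
  then show ?thesis using assms by (simp add: divide_right_mono)
qed (use assms in auto)

text \<open>For \<open>M < n\<close> the factor \<open>?c n \<le> ?c M\<close> cancels the
  denominator in \<open>total_weight_le\<close>, so what remains is a geometric series in
  \<open>t\<^sup>2\<close>.\<close>

lemma prob_largest_part_less_upper:
  assumes q: "q \<ge> 2" and n: "n > 0" and r: "r \<le> n"
  shows "prob_largest_part_less n q r \<le> (1 / (1 - 1 / q))\<^sup>2 * (1 / q) ^ (2 * (n + 1 - r))"
proof -
  define t where "t = 1 / q"
  have t: "0 < t" "t \<le> 1 / 2" using q by (auto simp: t_def field_simps)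
  let ?c = "qpoch q (1 / q)"
  have c: "?c k > 0" for k using q by (intro qpoch_pos) auto
  have "prob_largest_part_less n q r \<le> ?c n * (\<Sum>M = n + 1 - r..<n. t ^ (2 * M) / (1 - t) *
        (\<Sum>p\<in>partitions_of M. normalised_weight q p))"
    using q n sum_normalised_weight_le[of q n r] c[of n]
    by (simp add: prob_largest_part_less_eq t_def)
  also have "\<dots> = (\<Sum>M = n + 1 - r..<n. ?c n * (t ^ (2 * M) / (1 - t) *
        (\<Sum>p\<in>partitions_of M. normalised_weight q p)))"
    by (rule sum_distrib_left)
  also have "\<dots> \<le> (\<Sum>M = n + 1 - r..<n. t ^ (2 * M) / (1 - t) * (1 + t))"
  proof (rule sum_mono)
    fix M assume M: "M \<in> {n + 1 - r..<n}"
    have "?c n * (\<Sum>p\<in>partitions_of M. normalised_weight q p) \<le> ?c M * ((1 + t) / ?c M)"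
      using total_weight_le[OF q, of M] M q c
      by (intro mult_mono qpoch_antimono)
         (auto simp: t_def intro!: sum_nonneg less_imp_le[OF c]
            less_imp_le[OF normalised_weight_pos])
    then have "t ^ (2 * M) / (1 - t) * (?c n * (\<Sum>p\<in>partitions_of M. normalised_weight q p))
        \<le> t ^ (2 * M) / (1 - t) * (1 + t)"
      using t c[of M] by (intro mult_left_mono) auto
    then show "?c n * (t ^ (2 * M) / (1 - t) * (\<Sum>p\<in>partitions_of M. normalised_weight q p))
        \<le> t ^ (2 * M) / (1 - t) * (1 + t)"
      by (simp add: mult_ac)
  qed
  also have "\<dots> = (\<Sum>M = n + 1 - r..<n. (t\<^sup>2) ^ M) * ((1 + t) / (1 - t))"
    unfolding sum_distrib_right by (rule sum.cong) (simp_all add: power_mult)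
  also have "\<dots> \<le> (t\<^sup>2) ^ (n + 1 - r) / (1 - t\<^sup>2) * ((1 + t) / (1 - t))"
  proof (rule mult_right_mono)
    have t2: "t\<^sup>2 < 1" using t by (auto simp: power_less_one_iff)
    then show "(\<Sum>M = n + 1 - r..<n. (t\<^sup>2) ^ M) \<le> (t\<^sup>2) ^ (n + 1 - r) / (1 - t\<^sup>2)"
      by (intro geometric_sum_le) auto
  qed (use t in auto)
  also have "\<dots> = (1 / (1 - t))\<^sup>2 * t ^ (2 * (n + 1 - r))"
  proof -
    \<comment> \<open>The \<open>1 + t\<close> from the total weight cancels here, leaving exactly
      two factors \<open>1 / (1 - t)\<close>.\<close>
    have "1 - t\<^sup>2 = (1 - t) * (1 + t)" by (simp add: power2_eq_square algebra_simps)
    then show ?thesis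
      using t unfolding power_mult[of t 2] by (simp add: power_divide power2_eq_square[of "1 - t"])
  qed
  finally show ?thesis by (simp add: t_def)
qed

section \<open>Lower bound from a partition with two parts\<close>

text \<open>The first two factors stay exact because they cancel the denominators of a two-part
  weight. The summand \<open>(1 / q) ^ n\<close> strengthens the bound \<open>1 - 1 / q\<close> on
  the remaining factors so that it can be proved by induction.\<close>

lemma qpoch_ge:
  assumes q: "q \<ge> 2" and "n \<ge> 2"
  shows "qpoch q (1 / q) n \<ge> (1 - 1 / q) * (1 - (1 / q)\<^sup>2) * (1 - 1 / q + (1 / q) ^ n)"
  using assms(2)
proof (induction rule: dec_induct)
  case base
  have "(1 / q)\<^sup>2 \<le> 1 / q" using q power_decreasing[of 1 2 "1 / q"] by simp
  moreover have "(1 / q)\<^sup>2 \<le> 1" using q by (simp add: power_le_one)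
  ultimately show ?case using q
    by (auto simp: numeral_2_eq_2 qpoch_Suc qpoch_0 intro!: mult_left_le)
next
  case (step n)
  define t where "t = 1 / q"
  have t: "0 < t" "t \<le> 1 / 2" using q by (auto simp: t_def field_simps)
  have a: "t ^ n \<le> t" using t step power_decreasing[of 1 n t] by simp
  have t1: "t ^ Suc n \<le> 1" using t by (intro power_le_one) auto
  \<comment> \<open>Of the two copies of \<open>t ^ Suc n\<close> inside \<open>t ^ n\<close>, one
    pays for the new factor \<open>1 - t ^ Suc n\<close> and the other is kept for the next
    step.\<close>
  have "2 * t ^ Suc n \<le> t ^ n" using t mult_right_mono[of "2 * t" 1 "t ^ n"] by simp
  moreover have "(1 - t + t ^ n) * t ^ Suc n \<le> t ^ Suc n"
    using a t by (intro mult_left_le_one_le) auto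
  ultimately have "1 - t + t ^ Suc n \<le> (1 - t + t ^ n) * (1 - t ^ Suc n)"
    by (simp add: algebra_simps del: power_Suc)
  then have "(1 - t) * (1 - t\<^sup>2) * (1 - t + t ^ Suc n)
      \<le> (1 - t) * (1 - t\<^sup>2) * ((1 - t + t ^ n) * (1 - t ^ Suc n))"
    using t by (intro mult_left_mono) (auto simp: power_le_one)
  also have "\<dots> \<le> qpoch q (1 / q) n * (1 - t ^ Suc n)"
    using step.IH t1 by (simp add: t_def mult.assoc[symmetric] mult_right_mono del: power_Suc)
  finally show ?case by (simp add: qpoch_Suc t_def del: power_Suc)
qed

lemma prob_largest_part_less_lower:
  assumes q: "q \<ge> 2" and b: "0 < b" "b \<le> a" "a < r"
  shows "prob_largest_part_less (a + b) q r \<ge> (1 - 1 / q) * (1 / q) ^ (2 * b)"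
proof -
  define t where "t = 1 / q"
  have t: "0 < t" "t \<le> 1 / 2" using q by (auto simp: t_def field_simps)
  have q1: "q > 1" using q by simp
  let ?c = "qpoch q (1 / q)" and ?A = "{p \<in> partitions_of (a + b). largest_part p < r}"
  have c: "?c k > 0" for k using q by (intro qpoch_pos) auto
  have t2: "t\<^sup>2 < 1" "t\<^sup>2 \<le> t"
    using t power_decreasing[of 1 2 t] by (auto simp: power_less_one_iff)
  have "normalised_weight q {#b#} = 1 / (1 - t)"
    using normalised_weight_add_mset[OF q1 b(1), of "{#}"]
    by (simp add: normalised_weight_empty largest_part_def t_def)
  then have w: "normalised_weight q {#a, b#}
      = 1 / (1 - t) * t ^ (2 * b) / (1 - t ^ Suc (count {#b#} a))"
    using normalised_weight_add_mset[OF q1, of a "{#b#}"] b by (simp add: largest_part_def t_def)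
  \<comment> \<open>The exponent is \<open>2\<close> if \<open>a = b\<close> and \<open>1\<close>
    otherwise, so \<open>1 - t\<^sup>2\<close> serves both cases.\<close>
  have "1 - t ^ Suc (count {#b#} a) \<le> 1 - t\<^sup>2" "1 - t ^ Suc (count {#b#} a) > 0"
    using t t2 by (auto simp: power2_eq_square)
  then have "1 / (1 - t) * t ^ (2 * b) / (1 - t\<^sup>2) \<le> normalised_weight q {#a, b#}"
    unfolding w using t t2 by (intro divide_left_mono mult_pos_pos) auto
  also have "\<dots> \<le> (\<Sum>p\<in>?A. normalised_weight q p)"
  proof (rule member_le_sum)
    show "{#a, b#} \<in> ?A" using b by (auto simp: partitions_of_def largest_part_def)
  qed (use normalised_weight_pos[OF q1] in \<open>auto simp: finite_partitions_of less_imp_le\<close>)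
  finally have "?c (a + b) * (1 / (1 - t) * t ^ (2 * b) / (1 - t\<^sup>2))
      \<le> prob_largest_part_less (a + b) q r"
    unfolding prob_largest_part_less_eq[OF q1] by (rule mult_left_mono) (rule less_imp_le[OF c])
  moreover have "(1 - t) * (1 - t\<^sup>2) * (1 - t) \<le> ?c (a + b)"
  proof -
    have "(1 - t) * (1 - t\<^sup>2) * (1 - t) \<le> (1 - t) * (1 - t\<^sup>2) * (1 - t + t ^ (a + b))"
      using t t2 by (intro mult_left_mono) auto
    then show ?thesis using qpoch_ge[OF q, of "a + b"] b by (simp add: t_def)
  qed
  \<comment> \<open>The denominators \<open>1 - t\<close> and \<open>1 - t\<^sup>2\<close> cancel,
    and the third factor \<open>1 - t\<close> survives.\<close>
  then have "(1 - t) * (1 - t\<^sup>2) * (1 - t) * (1 / (1 - t) * t ^ (2 * b) / (1 - t\<^sup>2))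
      \<le> ?c (a + b) * (1 / (1 - t) * t ^ (2 * b) / (1 - t\<^sup>2))"
    using t t2 by (intro mult_right_mono) auto
  moreover have "(1 - t) * (1 - t\<^sup>2) * (1 - t) * (1 / (1 - t) * t ^ (2 * b) / (1 - t\<^sup>2))
      = (1 - t) * t ^ (2 * b)"
    using t t2 by simp
  ultimately show ?thesis by (simp add: t_def)
qed

section \<open>Both bounds in the stated form\<close>

theorem theorem2:
  fixes q :: real and n r :: nat
  assumes "q \<ge> 2" and "n > 0" and "r > 0" and "r \<le> n - 1"
  shows "prob_largest_part_less n q r \<le>
           (1 / (1 - 1 / q))\<^sup>2 *
           (1 / q ^ (2 * n - 2 * r + 2) + 1 / (1 - 1 / q ^ (2 * n + 1)) * (1 / q ^ (n + 1))) \<and>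
         prob_largest_part_less n q r \<ge>
           1 / q ^ (2 * n - 2 * r + 2)
           - 1 / (q ^ (n + 1) * (1 - 1 / q))
           - 1 / (q ^ (2 * n - 2 * r + 3) * (1 - 1 / q)\<^sup>2)
           - 1 / (q ^ (3 * n - 3 * r + 4) * (1 - 1 / q) ^ 3)
           - 1 / (1 - 1 / q)\<^sup>2 * (1 / (q ^ (2 * n + 3) * (1 - 1 / q ^ (2 * n + 3))))"
    (is "?P \<le> ?k * (?x + ?y) \<and> ?P \<ge> ?x - ?e1 - ?e2 - ?e3 - ?e4")
proof
  define t where "t = 1 / q"
  have t: "0 < t" "t \<le> 1 / 2" using assms by (auto simp: t_def field_simps)
  have pw: "1 / q ^ k < 1" if "k > 0" for k
    using assms(1) that by (simp add: one_less_power)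
  \<comment> \<open>Since \<open>r \<le> n\<close>, truncated subtraction agrees with the integer
    one.\<close>
  have B: "2 * n - 2 * r + 2 = 2 * (n + 1 - r)" using assms by auto
  have x: "?x = t ^ (2 * (n + 1 - r))" unfolding B by (simp add: t_def power_divide)
  have "?P \<le> ?k * ?x"
    using prob_largest_part_less_upper[of q n r] assms unfolding x by (simp add: t_def)
  also have "\<dots> \<le> ?k * (?x + ?y)"
    using assms(1) pw[of "2 * n + 1"] by (intro mult_left_mono) auto
  finally show "?P \<le> ?k * (?x + ?y)" .
  \<comment> \<open>\<open>?e1\<close> dominates \<open>?x\<close> when no partition
    \<open>(r - 1, n - r + 1)\<close> in decreasing order is available.\<close>
  have e1: "?e1 \<ge> t ^ (n + 1)"
  proof -
    have "?e1 = t ^ (n + 1) / (1 - t)" by (simp add: t_def power_divide)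
    moreover have "t ^ (n + 1) \<le> t ^ (n + 1) / (1 - t)"
      using t by (simp add: le_divide_eq mult_left_le)
    ultimately show ?thesis by simp
  qed
  \<comment> \<open>\<open>?e2\<close> absorbs the loss \<open>t * ?x\<close> in the bound
    \<open>(1 - t) * ?x\<close> of \<open>prob_largest_part_less_lower\<close>.\<close>
  have e2: "?e2 \<ge> t * ?x"
  proof -
    have "?e2 = t * ?x / (1 - t)\<^sup>2"
      by (simp add: t_def power_divide numeral_3_eq_3 numeral_2_eq_2)
    moreover have "0 < (1 - t)\<^sup>2" "(1 - t)\<^sup>2 \<le> 1" using t by (auto intro: power_le_one)
    moreover have "t * ?x \<ge> 0" using t x by simp
    ultimately show ?thesis by (simp only: le_divide_eq if_True mult_left_le)
  qed
  have e3: "?e3 \<ge> 0" using assms(1) by simp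
  have e4: "?e4 \<ge> 0" using assms(1) pw[of "2 * n + 3"] by simp
  show "?x - ?e1 - ?e2 - ?e3 - ?e4 \<le> ?P"
  proof (cases "n + 1 - r \<le> r - 1")
    case True
    then have "(1 - t) * ?x \<le> ?P"
      using prob_largest_part_less_lower[of q "n + 1 - r" "r - 1" r] assms unfolding x
      by (simp add: t_def)
    moreover have "?e1 \<ge> 0" using assms(1) by simp
    ultimately show ?thesis using e2 e3 e4 unfolding left_diff_distrib by linarith
  next
    case False
    \<comment> \<open>Now \<open>n + 1 - r \<ge> r\<close>, hence
      \<open>2 * (n + 1 - r) \<ge> n + 1\<close>.\<close>
    then have "?x \<le> t ^ (n + 1)" unfolding x using t by (intro power_decreasing) auto
    moreover have "?P \<ge> 0" by (simp add: prob_largest_part_less_def)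
    moreover have "t * ?x \<ge> 0" using t x by simp
    ultimately show ?thesis using e1 e2 e3 e4 by linarith
  qed
qed

end
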